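(* Let $n\ge0$, let $S\in\mathbb{Z}^{n\times n}$ be symmetric, positive definite and even, and let $S_0=\begin{pmatrix}0&0&1\\0&-S&0\\1&0&0\end{pmatrix}$, $S_1=\begin{pmatrix}0&0&1\\0&S_0&0\\1&0&0\end{pmatrix}\in\mathbb{Z}^{(n+4)\times(n+4)}$. Let $\Gamma_S=SO^+(S_1;\mathbb{R})\cap\mathbb{Z}^{(n+4)\times(n+4)}$ and $\widetilde{\Gamma}_S=\{M\in\Gamma_S: M\in I+\mathbb{Z}^{(n+4)\times(n+4)}S_1\}$. For $h\in\mathbb{Z}^{n+4}$ the following are equivalent: (i) $h$ is the first column of a matrix in $\Gamma_S$; (ii) $h^{tr}S_1$ is the last row of a matrix in $\Gamma_S$; (iii) $h^{tr}S_1h=0$ and $\gcd(S_1h)=1$. Likewise, the following are equivalent: (i') $h$ is the first column of a matrix in $\widetilde{\Gamma}_S$; (ii') $h^{tr}S_1$ is the last row of a matrix in $\widetilde{\Gamma}_S$; (iii) $h^{tr}S_1h=0$ and $\gcd(S_1h)=1$.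
   Context: A matrix is even if it is symmetric with even diagonal entries. $SO(S_1;\mathbb{R})=\{M\in SL(n+4;\mathbb{R}): M^{tr}S_1M=S_1\}$ and $SO^+(S_1;\mathbb{R})$ is its connected component of the identity. For an integer vector $v$, $\gcd(v)$ denotes the greatest common divisor of its entries. $I$ is the identity matrix. *)

theory Defs
  imports
    "HOL-Analysis.Function_Topology"
    "Jordan_Normal_Form.Determinant"
begin

definition even_mat :: "nat \<Rightarrow> int mat \<Rightarrow> bool" where
  "even_mat n A \<longleftrightarrow>
     A \<in> carrier_mat n n \<and> transpose_mat A = A \<and> (\<forall>i<n. even (A $$ (i, i)))"

definition pos_def_mat :: "nat \<Rightarrow> real mat \<Rightarrow> bool" where
  "pos_def_mat n A \<longleftrightarrow>
     A \<in> carrier_mat n n \<and> transpose_mat A = A \<and>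
     (\<forall>x \<in> carrier_vec n. x \<noteq> 0\<^sub>v n \<longrightarrow> scalar_prod x (A *\<^sub>v x) > 0)"

text \<open>For a square matrix \<open>A\<close>, the block matrix with rows \<open>(0, 0, 1)\<close>, \<open>(0, A, 0)\<close>, \<open>(1, 0, 0)\<close>.\<close>

definition hyp_extend :: "int mat \<Rightarrow> int mat" where
  "hyp_extend A = (let m = dim_row A in
     mat (m + 2) (m + 2) (\<lambda>(i, j).
       if i = 0 \<and> j = m + 1 \<or> i = m + 1 \<and> j = 0 then 1
       else if i \<in> {1..m} \<and> j \<in> {1..m} then A $$ (i - 1, j - 1)
       else 0))"

definition S0 :: "int mat \<Rightarrow> int mat" where
  "S0 S = hyp_extend (- S)"

definition S1 :: "int mat \<Rightarrow> int mat" where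
  "S1 S = hyp_extend (S0 S)"

text \<open>The type of matrices carries no topology. The Euclidean topology on real \<open>m \<times> m\<close> matrices
  is the pullback of the product topology along the map sending a matrix to its family of entries;
  the restriction to valid indices is needed because \<open>A $$ (i, j)\<close> is unspecified elsewhere.\<close>

definition mat_topology :: "nat \<Rightarrow> real mat topology" where
  "mat_topology m =
     pullback_topology (carrier_mat m m)
       (\<lambda>A. restrict (\<lambda>ij. A $$ ij) ({..<m} \<times> {..<m}))
       (powertop_real ({..<m} \<times> {..<m}))"

lemma topspace_mat_topology: "topspace (mat_topology m) = carrier_mat m m"
  by (auto simp: mat_topology_def topspace_pullback_topology)

definition SL_real :: "nat \<Rightarrow> real mat set" where
  "SL_real m = {M \<in> carrier_mat m m. Determinant.det M = 1}"

definition SO_real :: "nat \<Rightarrow> real mat \<Rightarrow> real mat set" where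
  "SO_real m Q = {M \<in> SL_real m. transpose_mat M * Q * M = Q}"

definition SO_plus :: "nat \<Rightarrow> real mat \<Rightarrow> real mat set" where
  "SO_plus m Q =
     connected_component_of_set (subtopology (mat_topology m) (SO_real m Q)) (1\<^sub>m m)"

text \<open>The groups of integral matrices; \<open>n\<close> is the size of \<open>S\<close>, so \<open>S1 S\<close> has size \<open>n + 4\<close>.\<close>

definition Gamma :: "nat \<Rightarrow> int mat \<Rightarrow> int mat set" where
  "Gamma n S =
     {M \<in> carrier_mat (n + 4) (n + 4).
        map_mat real_of_int M \<in> SO_plus (n + 4) (map_mat real_of_int (S1 S))}"

definition Gamma_tilde :: "nat \<Rightarrow> int mat \<Rightarrow> int mat set" where
  "Gamma_tilde n S =
     {M \<in> Gamma n S. \<exists>X \<in> carrier_mat (n + 4) (n + 4). M = 1\<^sub>m (n + 4) + X * S1 S}"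

definition gcd_vec :: "int vec \<Rightarrow> int" where
  "gcd_vec v = Gcd (vec_set v)"

text \<open>The row vector \<open>h\<^sup>t\<^sup>r A\<close>, as a vector.\<close>

definition row_vec_mult :: "int vec \<Rightarrow> int mat \<Rightarrow> int vec" where
  "row_vec_mult h A = Matrix.row (mat_of_row h * A) 0"

end

theory Submission
  imports Defs
begin

text \<open>For an isotropic vector \<open>e\<close> and \<open>w\<close> orthogonal to \<open>e\<close>, the Eichler transvection
  \<open>x \<mapsto> x + (e,x) w - (w,x) e - q (e,x) e\<close> with \<open>q = (w,w)/2\<close> is an isometry of the form
  \<open>I + X S\<^sub>1\<close>; scaling \<open>w\<close> by \<open>t \<in> [0,1]\<close> connects it to the identity, so integral transvections
  lie in the discriminant kernel. In the orbit of \<open>h\<close> under products of transvections choose \<open>x\<close> with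
  \<open>\<bar>x\<^sub>0\<bar>\<close> minimal among the nonzero values. Division with remainder in the two hyperbolic planes,
  together with transvections by vectors of the definite part, shows that \<open>x\<^sub>0\<close> divides every entry of
  \<open>S\<^sub>1 x\<close>, hence \<open>x\<^sub>0 = \<plusminus>1\<close>, and \<open>x\<close> can then be moved to the first unit vector. The row
  statement follows by passing to the inverse matrix.\<close>

section \<open>Eichler transvections\<close>

lemma mat_eqI_mult_vec:
  fixes A B :: "'a::semiring_1 mat"
  assumes A: "A \<in> carrier_mat m n" and B: "B \<in> carrier_mat m n"
    and eq: "\<And>x. x \<in> carrier_vec n \<Longrightarrow> A *\<^sub>v x = B *\<^sub>v x"
  shows "A = B"
proof (rule eq_matI)
  fix i j assume "i < dim_row B" "j < dim_col B"
  then have ij: "i < m" "j < n" using B by auto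
  have "(A *\<^sub>v unit_vec n j) $ i = (B *\<^sub>v unit_vec n j) $ i" using eq by simp
  then show "A $$ (i, j) = B $$ (i, j)" using ij A B by simp
qed (use A B in auto)

section \<open>Symmetric bilinear forms over a commutative ring\<close>

locale quadratic_space =
  fixes N :: nat and Q :: "'a::comm_ring_1 mat"
  assumes Q [simp]: "Q \<in> carrier_mat N N" and sym: "transpose_mat Q = Q"
begin

definition bil :: "'a vec \<Rightarrow> 'a vec \<Rightarrow> 'a" where
  "bil x y = scalar_prod x (Q *\<^sub>v y)"

text \<open>\<open>q\<close> plays the role of half of \<open>bil w w\<close>; it is a separate
  argument because 2 need not be invertible in the ring. The shape \<open>1 + X * Q\<close> is the
  congruence that defines the discriminant kernel.\<close>

definition eichler :: "'a vec \<Rightarrow> 'a vec \<Rightarrow> 'a \<Rightarrow> 'a mat" where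
  "eichler e w q =
     1\<^sub>m N + mat N N (\<lambda>(i, j). w $ i * e $ j - e $ i * w $ j - q * e $ i * e $ j) * Q"

lemma Q_mult_vec_carrier [simp]: "x \<in> carrier_vec N \<Longrightarrow> Q *\<^sub>v x \<in> carrier_vec N"
  by (rule mult_mat_vec_carrier[OF Q])

lemma bil_commute: "x \<in> carrier_vec N \<Longrightarrow> y \<in> carrier_vec N \<Longrightarrow> bil x y = bil y x"
  unfolding bil_def
  using transpose_vec_mult_scalar[OF Q, of y x] comm_scalar_prod[of "Q *\<^sub>v x" N y] sym by simp

lemma bil_unit: "i < N \<Longrightarrow> y \<in> carrier_vec N \<Longrightarrow> bil (unit_vec N i) y = (Q *\<^sub>v y) $ i"
  unfolding bil_def by (subst scalar_prod_left_unit) auto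

lemma bil_add_left:
  "\<lbrakk>x \<in> carrier_vec N; y \<in> carrier_vec N; z \<in> carrier_vec N\<rbrakk> \<Longrightarrow> bil (x + y) z = bil x z + bil y z"
  unfolding bil_def by (rule add_scalar_prod_distrib) auto

lemma bil_minus_left:
  "\<lbrakk>x \<in> carrier_vec N; y \<in> carrier_vec N; z \<in> carrier_vec N\<rbrakk> \<Longrightarrow> bil (x - y) z = bil x z - bil y z"
  unfolding bil_def by (rule minus_scalar_prod_distrib) auto

lemma bil_smult_left:
  "\<lbrakk>x \<in> carrier_vec N; z \<in> carrier_vec N\<rbrakk> \<Longrightarrow> bil (k \<cdot>\<^sub>v x) z = k * bil x z"
  unfolding bil_def by (rule smult_scalar_prod_distrib) auto

lemma bil_add_right:
  "\<lbrakk>x \<in> carrier_vec N; y \<in> carrier_vec N; z \<in> carrier_vec N\<rbrakk> \<Longrightarrow> bil z (x + y) = bil z x + bil z y"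
  by (simp add: bil_commute[of z] bil_add_left)

lemma bil_minus_right:
  "\<lbrakk>x \<in> carrier_vec N; y \<in> carrier_vec N; z \<in> carrier_vec N\<rbrakk> \<Longrightarrow> bil z (x - y) = bil z x - bil z y"
  by (simp add: bil_commute[of z] bil_minus_left)

lemma bil_smult_right:
  "\<lbrakk>x \<in> carrier_vec N; z \<in> carrier_vec N\<rbrakk> \<Longrightarrow> bil z (k \<cdot>\<^sub>v x) = k * bil z x"
  by (simp add: bil_commute[of z] bil_smult_left)

lemmas bil_simps =
  bil_add_left bil_minus_left bil_smult_left bil_add_right bil_minus_right bil_smult_right

section \<open>Composition, inversion and isometry of transvections\<close>

lemma eichler_carrier [simp]: "eichler e w q \<in> carrier_mat N N"
  unfolding eichler_def by (intro add_carrier_mat mult_carrier_mat[OF _ Q]) simp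

lemma eichler_mult_vec:
  assumes e: "e \<in> carrier_vec N" and w: "w \<in> carrier_vec N" and x: "x \<in> carrier_vec N"
  shows "eichler e w q *\<^sub>v x = x + bil e x \<cdot>\<^sub>v w - (bil w x + q * bil e x) \<cdot>\<^sub>v e"
proof (rule eq_vecI)
  let ?X = "mat N N (\<lambda>(i, j). w $ i * e $ j - e $ i * w $ j - q * e $ i * e $ j)"
  have *: "eichler e w q *\<^sub>v x = x + ?X *\<^sub>v (Q *\<^sub>v x)"
  proof -
    have "?X * Q \<in> carrier_mat N N" by (rule mult_carrier_mat[OF _ Q]) simp
    moreover have "?X * Q *\<^sub>v x = ?X *\<^sub>v (Q *\<^sub>v x)"
      using x by (intro assoc_mult_mat_vec[OF _ Q]) auto
    ultimately show ?thesis
      unfolding eichler_def using x by (simp add: add_mult_distrib_mat_vec[where nr = N and nc = N])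
  qed
  define y where "y = Q *\<^sub>v x"
  have y: "y \<in> carrier_vec N" using x by (simp add: y_def)
  have b: "bil v x = (\<Sum>j<N. v $ j * y $ j)" for v
    using y by (simp add: bil_def y_def[symmetric] scalar_prod_def atLeast0LessThan)
  fix i assume "i < dim_vec (x + bil e x \<cdot>\<^sub>v w - (bil w x + q * bil e x) \<cdot>\<^sub>v e)"
  then have i: "i < N" using e by simp
  have "(?X *\<^sub>v y) $ i = (\<Sum>j<N. (w $ i * e $ j - e $ i * w $ j - q * e $ i * e $ j) * y $ j)"
    using i y by (simp add: scalar_prod_def atLeast0LessThan)
  also have "\<dots> = w $ i * bil e x - e $ i * bil w x - q * e $ i * bil e x"
    by (simp add: b sum_distrib_left sum_subtractf sum.distrib algebra_simps)
  finally show "(eichler e w q *\<^sub>v x) $ i = (x + bil e x \<cdot>\<^sub>v w - (bil w x + q * bil e x) \<cdot>\<^sub>v e) $ i"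
    using i e w x by (simp add: * y_def[symmetric] algebra_simps)
qed (use e in \<open>auto simp: eichler_def\<close>)

text \<open>For fixed isotropic \<open>e\<close> composition is addition in \<open>w\<close>; the
  parameter \<open>q\<close> picks up the polarization term \<open>bil w w'\<close>, as half a norm
  does.\<close>

lemma eichler_mult:
  assumes e: "e \<in> carrier_vec N" and w: "w \<in> carrier_vec N" and w': "w' \<in> carrier_vec N"
    and iso: "bil e e = 0" "bil e w = 0" "bil e w' = 0"
  shows "eichler e w q * eichler e w' q' = eichler e (w + w') (q + q' + bil w w')"
proof (rule mat_eqI_mult_vec[where m = N and n = N])
  fix x :: "'a vec" assume x: "x \<in> carrier_vec N"
  have iso': "bil w e = 0" "bil w' e = 0" using iso e w w' by (auto simp: bil_commute)
  have "(eichler e w q * eichler e w' q') *\<^sub>v x = eichler e w q *\<^sub>v (eichler e w' q' *\<^sub>v x)"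
    using x by (intro assoc_mult_mat_vec[where n\<^sub>1 = N and n\<^sub>2 = N and n\<^sub>3 = N]) auto
  then show "(eichler e w q * eichler e w' q') *\<^sub>v x =
      eichler e (w + w') (q + q' + bil w w') *\<^sub>v x"
    using e w w' x by (intro eq_vecI) (auto simp: eichler_mult_vec bil_simps iso iso' algebra_simps)
qed (auto intro!: mult_carrier_mat[where n = N])

lemma eichler_zero: "eichler e (0\<^sub>v N) 0 = 1\<^sub>m N"
proof -
  have "mat N N (\<lambda>(i, j). 0\<^sub>v N $ i * e $ j - e $ i * 0\<^sub>v N $ j - 0 * e $ i * e $ j) = 0\<^sub>m N N"
    by (rule eq_matI) auto
  then show ?thesis unfolding eichler_def by (simp add: left_mult_zero_mat[OF Q])
qed

lemma eichler_inverse: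
  assumes "e \<in> carrier_vec N" "w \<in> carrier_vec N"
    and "bil e e = 0" "bil e w = 0" "2 * q = bil w w"
  shows "eichler e w q * eichler e (- w) q = 1\<^sub>m N"
proof -
  have m: "- w = (-1) \<cdot>\<^sub>v w" using assms by (intro eq_vecI) auto
  have *: "bil v (- w) = - bil v w" if "v \<in> carrier_vec N" for v
    using bil_smult_right[of w v "-1"] assms(2) that by (simp flip: m)
  \<comment> \<open>The second sum is \<open>2 * q - bil w w\<close>, so the product formula yields
    the transvection with zero parameters.\<close>
  have "bil e (- w) = 0" "q + q + bil w (- w) = 0" using assms * by (auto simp flip: mult_2)
  moreover have "w + - w = 0\<^sub>v N" using assms by (intro eq_vecI) auto
  ultimately show ?thesis using assms by (simp add: eichler_mult eichler_zero)
qed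

lemma isometry_iff:
  assumes M: "M \<in> carrier_mat N N"
  shows "transpose_mat M * Q * M = Q \<longleftrightarrow>
    (\<forall>x\<in>carrier_vec N. \<forall>y\<in>carrier_vec N. bil (M *\<^sub>v x) (M *\<^sub>v y) = bil x y)"
proof -
  have b: "bil (M *\<^sub>v x) (M *\<^sub>v y) = scalar_prod x ((transpose_mat M * Q * M) *\<^sub>v y)"
    if xy: "x \<in> carrier_vec N" "y \<in> carrier_vec N" for x y
  proof -
    have "(transpose_mat M * Q * M) *\<^sub>v y = transpose_mat M *\<^sub>v (Q *\<^sub>v (M *\<^sub>v y))"
      using M xy by (simp add: assoc_mult_mat_vec[where n\<^sub>1 = N and n\<^sub>2 = N and n\<^sub>3 = N])
    then show ?thesis
      using transpose_vec_mult_scalar[of "transpose_mat M" N N "Q *\<^sub>v (M *\<^sub>v y)" x] M xy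
      by (simp add: bil_def)
  qed
  have Mc: "transpose_mat M * Q * M \<in> carrier_mat N N"
    using M by (intro mult_carrier_mat[where n = N]) auto
  show ?thesis
  proof
    assume "transpose_mat M * Q * M = Q"
    then show "\<forall>x\<in>carrier_vec N. \<forall>y\<in>carrier_vec N. bil (M *\<^sub>v x) (M *\<^sub>v y) = bil x y"
      using b by (simp add: bil_def)
  next
    assume H: "\<forall>x\<in>carrier_vec N. \<forall>y\<in>carrier_vec N. bil (M *\<^sub>v x) (M *\<^sub>v y) = bil x y"
    show "transpose_mat M * Q * M = Q"
    proof (rule mat_eqI_mult_vec[OF Mc Q])
      fix y :: "'a vec" assume y: "y \<in> carrier_vec N"
      show "(transpose_mat M * Q * M) *\<^sub>v y = Q *\<^sub>v y"
      proof (rule eq_vecI)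
        fix i assume "i < dim_vec (Q *\<^sub>v y)"
        then have i: "i < N" using Q carrier_matD(1) by fastforce
        have "scalar_prod (unit_vec N i) ((transpose_mat M * Q * M) *\<^sub>v y)
            = scalar_prod (unit_vec N i) (Q *\<^sub>v y)"
          using H y by (subst b[symmetric]) (auto simp: bil_def)
        moreover have "(transpose_mat M * Q * M) *\<^sub>v y \<in> carrier_vec N" "Q *\<^sub>v y \<in> carrier_vec N"
          using y Mc by (auto intro!: mult_mat_vec_carrier)
        ultimately show "((transpose_mat M * Q * M) *\<^sub>v y) $ i = (Q *\<^sub>v y) $ i"
          using i scalar_prod_left_unit[of _ N i] by metis
      qed (use M Q in \<open>auto simp del: Q\<close>)
    qed
  qed
qed

lemma eichler_isometry:
  assumes "e \<in> carrier_vec N" "w \<in> carrier_vec N"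
    and "bil e e = 0" "bil e w = 0" "2 * q = bil w w"
  shows "transpose_mat (eichler e w q) * Q * eichler e w q = Q"
  unfolding isometry_iff[OF eichler_carrier]
proof (intro ballI)
  fix x y :: "'a vec" assume xy: "x \<in> carrier_vec N" "y \<in> carrier_vec N"
  have "bil w e = 0" "bil x e = bil e x" "bil x w = bil w x" 
    using assms xy by (auto simp: bil_commute)
  \<comment> \<open>After expansion the mixed terms cancel in pairs, leaving one term whose factor
    measures how far \<open>q\<close> is from half of \<open>bil w w\<close>.\<close>
  then have "bil (eichler e w q *\<^sub>v x) (eichler e w q *\<^sub>v y)
    = bil x y + bil e x * bil e y * (bil w w - 2 * q)"
    using assms(1-4) xy by (simp add: eichler_mult_vec bil_simps) (simp add: algebra_simps)
  then show "bil (eichler e w q *\<^sub>v x) (eichler e w q *\<^sub>v y) = bil x y"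
    using assms(5) by simp
qed

end

section \<open>Paths in the special orthogonal group\<close>

text \<open>A path from the identity witnesses membership in the identity component; paths multiply
  pointwise, which gives closure under products directly.\<close>

definition SO_path :: "nat \<Rightarrow> real mat \<Rightarrow> real mat \<Rightarrow> bool" where
  "SO_path m Q M \<longleftrightarrow> (\<exists>g. (\<forall>i<m. \<forall>j<m. continuous_on {0..1::real} (\<lambda>t. g t $$ (i, j))) \<and>
     (\<forall>t\<in>{0..1}. g t \<in> SO_real m Q) \<and> g 0 = 1\<^sub>m m \<and> g 1 = M)"

text \<open>The image of the unit interval is a connected set containing both the identity and
  \<open>M\<close>.\<close>

lemma SO_path_imp_SO_plus:
  assumes "SO_path m Q M"
  shows "M \<in> SO_plus m Q"
proof -
  obtain g where g: "\<And>i j. i < m \<Longrightarrow> j < m \<Longrightarrow> continuous_on {0..1::real} (\<lambda>t. g t $$ (i, j))"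
    "\<And>t. t \<in> {0..1} \<Longrightarrow> g t \<in> SO_real m Q" "g 0 = 1\<^sub>m m" "g 1 = M"
    using assms unfolding SO_path_def by blast
  have gm: "g t \<in> carrier_mat m m" if "t \<in> {0..1}" for t
    using g(2)[OF that] by (simp add: SO_real_def SL_real_def)
  let ?X = "subtopology (mat_topology m) (SO_real m Q)"
  have "continuous_map (top_of_set {0..1}) (mat_topology m) g"
    unfolding mat_topology_def
  \<comment> \<open>Continuity into the pullback topology is continuity of the entry map composed
    with \<open>g\<close>, which is checked coordinatewise.\<close>
  proof (rule continuous_map_pullback')
    show "continuous_map (top_of_set {0..1}) (powertop_real ({..<m} \<times> {..<m}))
      ((\<lambda>A. restrict (\<lambda>ij. A $$ ij) ({..<m} \<times> {..<m})) \<circ> g)"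
      unfolding continuous_map_componentwise using g(1) by auto
  qed (use gm in auto)
  then have "continuous_map (top_of_set {0..1}) ?X g"
    using g(2) by (auto simp: continuous_map_in_subtopology)
  then have "connectedin ?X (g ` {0..1})"
    by (rule connectedin_continuous_map_image) (simp add: connectedin_subtopology)
  moreover have "1\<^sub>m m \<in> g ` {0..1}" "M \<in> g ` {0..1}"
    using g(3,4) by (auto simp: image_iff intro: bexI[of _ 0] bexI[of _ 1])
  ultimately show ?thesis unfolding SO_plus_def connected_component_of_set by blast
qed

lemma SO_plus_subset: "SO_plus m Q \<subseteq> SO_real m Q"
  using connected_component_of_subset_topspace[of "subtopology (mat_topology m) (SO_real m Q)"]
  by (auto simp: SO_plus_def)

lemma SO_real_mult:
  assumes Q: "Q \<in> carrier_mat m m" and A: "A \<in> SO_real m Q" and B: "B \<in> SO_real m Q"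
  shows "A * B \<in> SO_real m Q"
proof -
  have AB: "A \<in> carrier_mat m m" "B \<in> carrier_mat m m" 
    and eq: "transpose_mat A * Q * A = Q" "transpose_mat B * Q * B = Q"
    using A B by (auto simp: SO_real_def SL_real_def)
  note c = mult_carrier_mat[where nr = m and n = m and nc = m]
  have "transpose_mat (A * B) * Q * (A * B) = transpose_mat B * transpose_mat A * Q * (A * B)"
    using AB by (simp add: transpose_mult)
  also have "\<dots> = transpose_mat B * (transpose_mat A * Q * A) * B"
    using AB Q by (simp add: assoc_mult_mat[where n\<^sub>1 = m and n\<^sub>2 = m and n\<^sub>3 = m and n\<^sub>4 = m] c)
  finally have "transpose_mat (A * B) * Q * (A * B) = Q" using eq by simp
  then show ?thesis
    using A B AB by (auto simp: SO_real_def SL_real_def det_mult intro!: c)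
qed

lemma SO_path_mult:
  assumes Q: "Q \<in> carrier_mat m m" and A: "SO_path m Q A" and B: "SO_path m Q B"
  shows "SO_path m Q (A * B)"
proof -
  obtain f where f: "\<And>i j. i < m \<Longrightarrow> j < m \<Longrightarrow> continuous_on {0..1::real} (\<lambda>t. f t $$ (i, j))"
    "\<And>t. t \<in> {0..1} \<Longrightarrow> f t \<in> SO_real m Q" "f 0 = 1\<^sub>m m" "f 1 = A"
    using A unfolding SO_path_def by blast
  obtain g where g: "\<And>i j. i < m \<Longrightarrow> j < m \<Longrightarrow> continuous_on {0..1::real} (\<lambda>t. g t $$ (i, j))"
    "\<And>t. t \<in> {0..1} \<Longrightarrow> g t \<in> SO_real m Q" "g 0 = 1\<^sub>m m" "g 1 = B"
    using B unfolding SO_path_def by blast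
  have c: "f t \<in> carrier_mat m m" "g t \<in> carrier_mat m m" if "t \<in> {0..1}" for t
    using f(2)[OF that] g(2)[OF that] by (auto simp: SO_real_def SL_real_def)
  have "continuous_on {0..1} (\<lambda>t. (f t * g t) $$ (i, j))" if ij: "i < m" "j < m" for i j
  proof -
    have "continuous_on {0..1} (\<lambda>t. \<Sum>k<m. f t $$ (i, k) * g t $$ (k, j))"
      by (intro continuous_intros f g ij) auto
    moreover have "(f t * g t) $$ (i, j) = (\<Sum>k<m. f t $$ (i, k) * g t $$ (k, j))"
      if "t \<in> {0..1}" for t
      using c[OF that] ij by (simp add: scalar_prod_def atLeast0LessThan)
    ultimately show ?thesis by (auto intro: continuous_on_eq)
  qed
  then show ?thesis
    unfolding SO_path_def using f(2-4) g(2-4) SO_real_mult[OF Q]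
    by (intro exI[of _ "\<lambda>t. f t * g t"]) auto
qed

text \<open>Shows each entry as a polynomial in \<open>t\<close> and \<open>q\<close>, which makes
  continuity along the scaling path immediate.\<close>

lemma (in quadratic_space) eichler_smult_index:
  assumes "e \<in> carrier_vec N" "w \<in> carrier_vec N" "i < N" "j < N"
  shows "eichler e (t \<cdot>\<^sub>v w) q $$ (i, j) = (if i = j then 1 else 0) +
    (\<Sum>k<N. (t * w $ i * e $ k - e $ i * (t * w $ k) - q * e $ i * e $ k) * Q $$ (k, j))"
proof -
  let ?X = "mat N N (\<lambda>(i, j). (t \<cdot>\<^sub>v w) $ i * e $ j - e $ i * (t \<cdot>\<^sub>v w) $ j - q * e $ i * e $ j)"
  have "?X * Q \<in> carrier_mat N N" by (rule mult_carrier_mat[OF _ Q]) simp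
  moreover have "(?X * Q) $$ (i, j) =
     (\<Sum>k<N. (t * w $ i * e $ k - e $ i * (t * w $ k) - q * e $ i * e $ k) * Q $$ (k, j))"
    using assms carrier_matD[OF Q]
    by (subst index_mult_mat) (auto simp: scalar_prod_def atLeast0LessThan intro!: sum.cong)
  ultimately show ?thesis using assms carrier_matD[OF Q] by (simp add: eichler_def)
qed

lemma SO_path_eichler:
  fixes Q :: "real mat"
  assumes "quadratic_space N Q" and nondeg: "Determinant.det Q \<noteq> 0"
    and e: "e \<in> carrier_vec N" and w: "w \<in> carrier_vec N"
    and ee: "quadratic_space.bil Q e e = 0" and ew: "quadratic_space.bil Q e w = 0"
    and q: "2 * q = quadratic_space.bil Q w w"
  shows "SO_path N Q (quadratic_space.eichler N Q e w q)"
proof -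
  interpret quadratic_space N Q by fact
  \<comment> \<open>\<open>q\<close> scales quadratically, as half a norm does, so
    \<open>2 * q = bil w w\<close> persists for every \<open>t\<close>.\<close>
  define g where "g t = eichler e (t \<cdot>\<^sub>v w) (t\<^sup>2 * q)" for t
  have iso: "bil e (t \<cdot>\<^sub>v w) = 0" "2 * (t\<^sup>2 * q) = bil (t \<cdot>\<^sub>v w) (t \<cdot>\<^sub>v w)" for t
    using e w ew q by (auto simp: bil_simps power2_eq_square)
  have gc: "g t \<in> carrier_mat N N" for t by (simp add: g_def)
  have isog: "transpose_mat (g t) * Q * g t = Q" for t
    unfolding g_def using e w ee iso by (intro eichler_isometry) auto
  \<comment> \<open>An isometry has determinant \<open>\<plusminus>1\<close>, and \<open>g t\<close> is the square of the isometry \<open>g (t/2)\<close>.\<close>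
  have "(Determinant.det (g t))\<^sup>2 = 1" for t
  proof -
    have "Determinant.det (transpose_mat (g t) * Q * g t) = (Determinant.det (g t))\<^sup>2 * Determinant.det Q"
      using gc[of t] Q mult_carrier_mat[OF _ Q, of "transpose_mat (g t)" N]
      by (simp add: det_mult[where n = N] det_transpose power2_eq_square)
    then show ?thesis using isog[of t] nondeg by simp
  qed
  moreover have "g t = g (t/2) * g (t/2)" for t
  proof -
    have "(t/2) \<cdot>\<^sub>v w + (t/2) \<cdot>\<^sub>v w = t \<cdot>\<^sub>v w" using w by (intro eq_vecI) auto
    moreover have "(t/2)\<^sup>2 * q + (t/2)\<^sup>2 * q + bil ((t/2) \<cdot>\<^sub>v w) ((t/2) \<cdot>\<^sub>v w) = t\<^sup>2 * q"
      unfolding iso(2)[symmetric] by (simp add: power2_eq_square)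
    ultimately show ?thesis
      unfolding g_def using e w ee iso by (subst eichler_mult) auto
  qed
  ultimately have det: "Determinant.det (g t) = 1" for t
    using det_mult[OF gc gc] by (metis power2_eq_square)
  have "continuous_on {0..1} (\<lambda>t. g t $$ (i, j))" if "i < N" "j < N" for i j
    unfolding g_def eichler_smult_index[OF e w that] by (intro continuous_intros)
  moreover have "g 0 = 1\<^sub>m N"
  proof -
    have "0 \<cdot>\<^sub>v w = 0\<^sub>v N" using w by (intro eq_vecI) auto
    then show ?thesis by (simp add: g_def eichler_zero)
  qed
  moreover have "g 1 = eichler e w q" by (simp add: g_def)
  ultimately show ?thesis
    unfolding SO_path_def using gc isog det
    by (intro exI[of _ g]) (auto simp: SO_real_def SL_real_def)
qed

section \<open>Orbits of the discriminant kernel\<close>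

text \<open>Evenness makes \<open>bil w w div 2\<close> an exact half, so integral \<open>w\<close>
  give integral transvections; \<open>nondeg\<close> allows the determinant of \<open>Q\<close> to
  be cancelled, so that isometries have determinant 1 or -1.\<close>

locale even_lattice = quadratic_space N Q for N and Q :: "int mat" +
  assumes nondeg: "Determinant.det Q \<noteq> 0"
    and even_bil: "x \<in> carrier_vec N \<Longrightarrow> even (bil x x)"
begin

abbreviation "Qr \<equiv> map_mat real_of_int Q"

sublocale real: quadratic_space N Qr
proof
  show "transpose_mat Qr = Qr" using sym by (simp add: map_mat_transpose)
qed simp

text \<open>The congruence says that \<open>M\<close> acts trivially on the discriminant group, the
  dual lattice modulo the lattice.\<close>

definition stable :: "int mat set" where
  "stable = {M \<in> carrier_mat N N. SO_path N Qr (map_mat real_of_int M) \<and>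
     (\<exists>X\<in>carrier_mat N N. M = 1\<^sub>m N + X * Q)}"

text \<open>The inverse is carried along because both matrices are used in the end: if
  \<open>h\<close> is moved to the first unit vector, \<open>M'\<close> provides the column and
  \<open>M\<close> the row.\<close>

definition orb :: "int vec \<Rightarrow> int vec \<Rightarrow> bool" where
  "orb x y \<longleftrightarrow> x \<in> carrier_vec N \<and> y \<in> carrier_vec N \<and>
     (\<exists>M\<in>stable. \<exists>M'\<in>stable. M * M' = 1\<^sub>m N \<and> M' * M = 1\<^sub>m N \<and> M *\<^sub>v x = y \<and> M' *\<^sub>v y = x)"

lemma real_bil: 
  assumes "x \<in> carrier_vec N" "y \<in> carrier_vec N"
  shows "real.bil (map_vec real_of_int x) (map_vec real_of_int y) = real_of_int (bil x y)"
proof -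
  have "real.bil (map_vec real_of_int x) (map_vec real_of_int y)
    = scalar_prod (map_vec real_of_int x) (map_vec real_of_int (Q *\<^sub>v y))"
    unfolding real.bil_def using assms by (simp add: of_int_hom.mult_mat_vec_hom[OF Q])
  then show ?thesis
    using assms carrier_vecD[OF Q_mult_vec_carrier[OF assms(2)]]
    by (simp add: bil_def scalar_prod_def)
qed

lemma real_eichler:
  assumes "e \<in> carrier_vec N" "w \<in> carrier_vec N"
  shows "map_mat real_of_int (eichler e w q) =
    real.eichler (map_vec real_of_int e) (map_vec real_of_int w) (real_of_int q)"
proof -
  let ?X = "mat N N (\<lambda>(i, j). w $ i * e $ j - e $ i * w $ j - q * e $ i * e $ j)"
  have X: "?X \<in> carrier_mat N N" "?X * Q \<in> carrier_mat N N" by (auto intro: mult_carrier_mat[OF _ Q])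
  have "map_mat real_of_int ?X = mat N N (\<lambda>(i, j). map_vec real_of_int w $ i * map_vec real_of_int e $ j
     - map_vec real_of_int e $ i * map_vec real_of_int w $ j
     - real_of_int q * map_vec real_of_int e $ i * map_vec real_of_int e $ j)"
    using assms by (intro eq_matI) auto
  moreover have "map_mat real_of_int (1\<^sub>m N + ?X * Q) = 1\<^sub>m N + map_mat real_of_int ?X * Qr"
    unfolding of_int_hom.mat_hom_mult[OF X(1) Q, symmetric] using X(2) by (intro eq_matI) auto
  ultimately show ?thesis unfolding eichler_def real.eichler_def by simp
qed

text \<open>The congruence is multiplicative: (1 + XQ)(1 + YQ) = 1 + (Y + X + XQY)Q. The paths are
  multiplied pointwise.\<close>

lemma stable_mult:
  assumes "A \<in> stable" "B \<in> stable"
  shows "A * B \<in> stable"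
proof -
  obtain X Y where AB: "A \<in> carrier_mat N N" "B \<in> carrier_mat N N"
    and XY: "X \<in> carrier_mat N N" "Y \<in> carrier_mat N N" "A = 1\<^sub>m N + X * Q" "B = 1\<^sub>m N + Y * Q"
    and p: "SO_path N Qr (map_mat real_of_int A)" "SO_path N Qr (map_mat real_of_int B)"
    using assms by (auto simp: stable_def)
  note c = mult_carrier_mat[where nr = N and n = N and nc = N]
  note a = assoc_mult_mat[where n\<^sub>1 = N and n\<^sub>2 = N and n\<^sub>3 = N and n\<^sub>4 = N]
  have "A * B = B + X * Q * B"
    unfolding XY(3) using XY AB by (subst add_mult_distrib_mat[where nr = N and n = N and nc = N]) (auto intro!: c)
  also have "X * Q * B = X * Q + X * (Q * (Y * Q))"
    unfolding XY(4) using XY Q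
    by (subst mult_add_distrib_mat[where nr = N and n = N and nc = N]) (auto intro!: c simp: a c right_mult_one_mat[OF Q])
  also have "B + (X * Q + X * (Q * (Y * Q))) = 1\<^sub>m N + (Y + (X + X * Q * Y)) * Q"
    unfolding XY(4) using XY Q
    by (simp add: add_mult_distrib_mat[where nr = N and n = N and nc = N] a c
         assoc_add_mat[where nr = N and nc = N])
  finally have "A * B = 1\<^sub>m N + (Y + (X + X * Q * Y)) * Q" .
  moreover have "Y + (X + X * Q * Y) \<in> carrier_mat N N" using XY Q by (simp add: c)
  moreover have "SO_path N Qr (map_mat real_of_int (A * B))"
    using SO_path_mult[OF real.Q p] by (simp add: of_int_hom.mat_hom_mult[OF AB])
  ultimately show ?thesis using AB by (auto simp: stable_def c)
qed

lemma real_isometry_imp_isometry: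
  assumes M: "M \<in> carrier_mat N N"
    and iso: "transpose_mat (map_mat real_of_int M) * Qr * map_mat real_of_int M = Qr"
  shows "transpose_mat M * Q * M = Q"
proof -
  have "transpose_mat (map_mat real_of_int M) * Qr * map_mat real_of_int M
      = map_mat real_of_int (transpose_mat M * Q * M)"
    using M mult_carrier_mat[OF transpose_carrier_mat[THEN iffD2, OF M] Q]
    by (simp add: of_int_hom.mat_hom_mult[where nr = N and n = N and nc = N] map_mat_transpose)
  then show ?thesis using iso by (metis of_int_hom.mat_hom_inj)
qed

lemma stable_isometry:
  assumes "M \<in> stable"
  shows "transpose_mat M * Q * M = Q"
proof (rule real_isometry_imp_isometry)
  show "M \<in> carrier_mat N N" using assms by (simp add: stable_def)
  have "SO_path N Qr (map_mat real_of_int M)" using assms by (simp add: stable_def)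
  then show "transpose_mat (map_mat real_of_int M) * Qr * map_mat real_of_int M = Qr"
    using SO_path_imp_SO_plus SO_plus_subset by (fastforce simp: SO_real_def)
qed

lemma stable_eichler:
  assumes e: "e \<in> carrier_vec N" and w: "w \<in> carrier_vec N"
    and "bil e e = 0" "bil e w = 0" "2 * q = bil w w"
  shows "eichler e w q \<in> stable"
proof -
  have "SO_path N Qr (map_mat real_of_int (eichler e w q))"
    unfolding real_eichler[OF e w]
  proof (rule SO_path_eichler[OF real.quadratic_space_axioms])
    show "2 * real_of_int q = real.bil (map_vec real_of_int w) (map_vec real_of_int w)"
      unfolding real_bil[OF w w] using assms(5) by linarith
  qed (use assms nondeg in \<open>auto simp: real_bil\<close>)
  moreover have "\<exists>X\<in>carrier_mat N N. eichler e w q = 1\<^sub>m N + X * Q"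
    unfolding eichler_def by (rule bexI, rule refl) simp
  ultimately show ?thesis by (simp add: stable_def)
qed

text \<open>The source of all moves below. The inverse is the transvection by \<open>- w\<close>
  with the same \<open>q\<close>, which is stable for the same reason.\<close>

lemma orb_eichler:
  assumes e: "e \<in> carrier_vec N" and w: "w \<in> carrier_vec N" and x: "x \<in> carrier_vec N"
    and iso: "bil e e = 0" "bil e w = 0"
  shows "orb x (x + bil e x \<cdot>\<^sub>v w - (bil w x + bil w w div 2 * bil e x) \<cdot>\<^sub>v e)"
proof -
  define q where "q = bil w w div 2"
  have q: "2 * q = bil w w" using even_bil[OF w] by (simp add: q_def)
  have mw: "- w \<in> carrier_vec N" "- (- w) = w" using w by auto
  have m: "- w = (-1) \<cdot>\<^sub>v w" using w by (intro eq_vecI) auto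
  have *: "bil v (- w) = - bil v w" if "v \<in> carrier_vec N" for v
    using bil_smult_right[of w v "-1"] w that by (simp flip: m)
  have *: "bil e (- w) = 0" "2 * q = bil (- w) (- w)"
    using * bil_commute[OF w mw(1)] mw w e iso q by auto
  let ?M = "eichler e w q" and ?M' = "eichler e (- w) q"
  have inv: "?M * ?M' = 1\<^sub>m N" "?M' * ?M = 1\<^sub>m N"
    using eichler_inverse[OF e w iso q] eichler_inverse[OF e mw(1) iso(1) *] mw by auto
  have "?M \<in> stable" "?M' \<in> stable"
    using stable_eichler[OF e w iso q] stable_eichler[OF e mw(1) iso(1) *] by auto
  moreover have "?M' *\<^sub>v (?M *\<^sub>v x) = x"
    using assoc_mult_mat_vec[OF eichler_carrier eichler_carrier x, of e "- w" q e w q] inv x by simp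
  moreover have "?M *\<^sub>v x \<in> carrier_vec N" using x by (rule mult_mat_vec_carrier[OF eichler_carrier])
  ultimately have "orb x (?M *\<^sub>v x)" unfolding orb_def using x inv by blast
  then show ?thesis unfolding eichler_mult_vec[OF e w x] q_def .
qed

lemma orb_trans [trans]:
  assumes "orb x y" "orb y z"
  shows "orb x z"
proof -
  obtain A A' where A: "A \<in> stable" "A' \<in> stable" "A * A' = 1\<^sub>m N" "A' * A = 1\<^sub>m N" "A *\<^sub>v x = y" "A' *\<^sub>v y = x"
    using assms by (auto simp: orb_def)
  obtain B B' where B: "B \<in> stable" "B' \<in> stable" "B * B' = 1\<^sub>m N" "B' * B = 1\<^sub>m N" "B *\<^sub>v y = z" "B' *\<^sub>v z = y"
    using assms by (auto simp: orb_def)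
  have x: "x \<in> carrier_vec N" "y \<in> carrier_vec N" "z \<in> carrier_vec N" using assms by (auto simp: orb_def)
  have c: "A \<in> carrier_mat N N" "A' \<in> carrier_mat N N" "B \<in> carrier_mat N N" "B' \<in> carrier_mat N N"
    using A B by (auto simp: stable_def)
  have *: "(K * L) * (L' * K') = 1\<^sub>m N"
    if "K \<in> carrier_mat N N" "L \<in> carrier_mat N N" "L' \<in> carrier_mat N N" "K' \<in> carrier_mat N N"
      and "L * L' = 1\<^sub>m N" "K * K' = 1\<^sub>m N" for K L L' K' :: "int mat"
  proof -
    have "(K * L) * (L' * K') = K * ((L * L') * K')"
      using that(1-4) by (simp add: assoc_mult_mat[where n\<^sub>1 = N and n\<^sub>2 = N and n\<^sub>3 = N and n\<^sub>4 = N]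
        mult_carrier_mat[where nr = N and n = N and nc = N])
    then show ?thesis using that by simp
  qed
  have "(B * A) *\<^sub>v x = z" "(A' * B') *\<^sub>v z = x"
    using A(5,6) B(5,6) x c by (simp_all add: assoc_mult_mat_vec[where n\<^sub>1 = N and n\<^sub>2 = N and n\<^sub>3 = N])
  then show ?thesis
    unfolding orb_def using *[OF c(3,1,2,4)] *[OF c(2,4,3,1)] A B stable_mult x by blast
qed

lemma orb_bil:
  assumes "orb x y"
  shows "bil y y = bil x x"
  using assms stable_isometry isometry_iff by (auto simp: orb_def stable_def)

text \<open>If \<open>M x = y\<close> then \<open>Q x = M\<^sup>T Q y\<close>, so the ideal generated by the entries of \<open>Q x\<close>
  is constant on orbits.\<close>

lemma isometry_dvd:
  assumes M: "M \<in> carrier_mat N N" and iso: "transpose_mat M * Q * M = Q"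
    and x: "x \<in> carrier_vec N" and dvd: "\<And>i. i < N \<Longrightarrow> d dvd (Q *\<^sub>v (M *\<^sub>v x)) $ i" and i: "i < N"
  shows "d dvd (Q *\<^sub>v x) $ i"
proof -
  define y where "y = Q *\<^sub>v (M *\<^sub>v x)"
  have y: "y \<in> carrier_vec N" using M x by (simp add: y_def)
  have "(transpose_mat M * Q * M) *\<^sub>v x = transpose_mat M *\<^sub>v y"
    using M Q x by (simp add: y_def assoc_mult_mat_vec[where n\<^sub>1 = N and n\<^sub>2 = N and n\<^sub>3 = N]
         mult_carrier_mat[where nr = N and n = N and nc = N])
  then have "(Q *\<^sub>v x) $ i = (\<Sum>k<N. M $$ (k, i) * y $ k)"
    using iso M i y by (simp add: scalar_prod_def atLeast0LessThan)
  then show ?thesis using dvd by (auto intro!: dvd_sum dvd_mult simp: y_def)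
qed

lemma orb_dvd:
  assumes "orb x y" "\<And>i. i < N \<Longrightarrow> d dvd (Q *\<^sub>v y) $ i" "i < N"
  shows "d dvd (Q *\<^sub>v x) $ i"
proof -
  obtain M where M: "M \<in> stable" "M *\<^sub>v x = y" "x \<in> carrier_vec N"
    using assms(1) by (auto simp: orb_def)
  have "M \<in> carrier_mat N N" using M(1) by (simp add: stable_def)
  then show ?thesis
    using isometry_dvd[OF _ stable_isometry[OF M(1)] M(3) _ assms(3)] assms(2) M(2) by simp
qed

end

text \<open>The pairs of indices \<open>(0, n + 3)\<close> and \<open>(1, n + 2)\<close> span the two hyperbolic planes; in fact names
  below, \<open>p\<close> stands for \<open>n + 2\<close>, \<open>l\<close> for \<open>n + 3\<close> and \<open>mid\<close> for the indices in between.\<close>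

locale hyperbolic_lattice = even_lattice "n + 4" Q for n and Q :: "int mat" +
  assumes Q_0: "x \<in> carrier_vec (n + 4) \<Longrightarrow> (Q *\<^sub>v x) $ 0 = x $ (n + 3)"
    and Q_1: "x \<in> carrier_vec (n + 4) \<Longrightarrow> (Q *\<^sub>v x) $ 1 = x $ (n + 2)"
    and Q_p: "x \<in> carrier_vec (n + 4) \<Longrightarrow> (Q *\<^sub>v x) $ (n + 2) = x $ 1"
    and Q_l: "x \<in> carrier_vec (n + 4) \<Longrightarrow> (Q *\<^sub>v x) $ (n + 3) = x $ 0"
begin

declare add_2_eq_Suc' [simp del]

abbreviation u :: "nat \<Rightarrow> int vec" where "u \<equiv> unit_vec (n + 4)"

text \<open>Pairing with a hyperbolic unit vector reads off the opposite coordinate. Index 1 is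
  listed also as \<open>Suc 0\<close>, the form in which the simplifier presents it.\<close>

lemma bil_u:
  assumes "x \<in> carrier_vec (n + 4)"
  shows "bil (u 0) x = x $ (n + 3)" "bil (u 1) x = x $ (n + 2)" "bil (u (Suc 0)) x = x $ (n + 2)"
    "bil (u (n + 2)) x = x $ 1" "bil (u (n + 3)) x = x $ 0"
  using assms Q_0 Q_1 Q_p Q_l by (auto simp: bil_unit)

lemma orb_carrier: "orb x y \<Longrightarrow> x \<in> carrier_vec (n + 4)" "orb x y \<Longrightarrow> y \<in> carrier_vec (n + 4)"
  by (auto simp: orb_def)

text \<open>Take \<open>e = u i\<close> and \<open>w = k \<cdot>\<^sub>v u j\<close>. As
  \<open>u j\<close> is isotropic, the quadratic term vanishes and an elementary operation on two
  coordinates remains.\<close>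

lemma orb_unit_unit:
  assumes x: "x \<in> carrier_vec (n + 4)" and ij: "i < n + 4" "j < n + 4"
    and iso: "bil (u i) (u i) = 0" "bil (u i) (u j) = 0" "bil (u j) (u j) = 0"
  shows "orb x (x + (k * bil (u i) x) \<cdot>\<^sub>v u j - (k * bil (u j) x) \<cdot>\<^sub>v u i)"
proof -
  have "orb x (x + bil (u i) x \<cdot>\<^sub>v (k \<cdot>\<^sub>v u j) -
      (bil (k \<cdot>\<^sub>v u j) x + bil (k \<cdot>\<^sub>v u j) (k \<cdot>\<^sub>v u j) div 2 * bil (u i) x) \<cdot>\<^sub>v u i)"
    using x iso by (intro orb_eichler) (auto simp: bil_simps)
  also have "bil (u i) x \<cdot>\<^sub>v (k \<cdot>\<^sub>v u j) = (k * bil (u i) x) \<cdot>\<^sub>v u j"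
    by (simp add: smult_smult_assoc mult.commute)
  finally show ?thesis using x iso by (simp add: bil_simps)
qed

text \<open>A Euclidean step between coordinates 0 and 1; its side effect falls on coordinate
  \<open>n + 2\<close>.\<close>

lemma orb_0_minus_1:
  assumes x: "x \<in> carrier_vec (n + 4)"
  obtains y where "orb x y" "y $ 0 = x $ 0 - k * x $ 1" "y $ 1 = x $ 1"
proof
  show "orb x (x + (k * bil (u 0) x) \<cdot>\<^sub>v u (n + 2) - (k * bil (u (n + 2)) x) \<cdot>\<^sub>v u 0)"
    using x by (intro orb_unit_unit) (auto simp: bil_u)
qed (use x in \<open>auto simp: bil_u\<close>)

lemma orb_0_minus_p:
  assumes x: "x \<in> carrier_vec (n + 4)"
  obtains y where "orb x y" "y $ 0 = x $ 0 - k * x $ (n + 2)" "y $ (n + 2) = x $ (n + 2)"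
proof
  show "orb x (x + (k * bil (u 0) x) \<cdot>\<^sub>v u 1 - (k * bil (u 1) x) \<cdot>\<^sub>v u 0)"
    using x by (intro orb_unit_unit) (auto simp: bil_u)
qed (use x in \<open>auto simp: bil_u\<close>)

text \<open>The side effect is confined to coordinate \<open>n + 3\<close>, so coordinates 1 and
  \<open>n + 2\<close> can be cleared one after the other without disturbing the middle.\<close>

lemma orb_1_minus_0:
  assumes x: "x \<in> carrier_vec (n + 4)"
  obtains y where "orb x y" "y $ 1 = x $ 1 - k * x $ 0" "y $ 0 = x $ 0" "y $ (n + 2) = x $ (n + 2)"
    "\<And>i. 2 \<le> i \<Longrightarrow> i < n + 2 \<Longrightarrow> y $ i = x $ i"
proof
  show "orb x (x + (k * bil (u 1) x) \<cdot>\<^sub>v u (n + 3) - (k * bil (u (n + 3)) x) \<cdot>\<^sub>v u 1)"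
    using x by (intro orb_unit_unit) (auto simp: bil_u)
qed (use x in \<open>auto simp: bil_u\<close>)

lemma orb_p_minus_0:
  assumes x: "x \<in> carrier_vec (n + 4)"
  obtains y where "orb x y" "y $ (n + 2) = x $ (n + 2) - k * x $ 0" "y $ 0 = x $ 0" "y $ 1 = x $ 1"
    "\<And>i. 2 \<le> i \<Longrightarrow> i < n + 2 \<Longrightarrow> y $ i = x $ i"
proof
  show "orb x (x + (k * bil (u (n + 2)) x) \<cdot>\<^sub>v u (n + 3) - (k * bil (u (n + 3)) x) \<cdot>\<^sub>v u (n + 2))"
    using x by (intro orb_unit_unit) (auto simp: bil_u)
qed (use x in \<open>auto simp: bil_u\<close>)

text \<open>Brings the last coordinate into position 1, where it can be compared with coordinate 0;
  the latter is kept when \<open>x $ (n + 2) = 0\<close>.\<close>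

lemma orb_1_plus_l:
  assumes x: "x \<in> carrier_vec (n + 4)"
  obtains y where "orb x y" "y $ 1 = x $ 1 + x $ (n + 3)" "y $ 0 = x $ 0 - x $ (n + 2)"
proof
  show "orb x (x + (- 1 * bil (u 1) x) \<cdot>\<^sub>v u 0 - (- 1 * bil (u 0) x) \<cdot>\<^sub>v u 1)"
    using x by (intro orb_unit_unit) (auto simp: bil_u)
qed (use x in \<open>auto simp: bil_u\<close>)

text \<open>For \<open>e = u 0\<close> the factor \<open>bil e x\<close> is
  \<open>x $ (n + 3) = 0\<close>. This removes the \<open>w\<close> term and the quadratic term, and
  only \<open>bil (u i) x\<close> is subtracted.\<close>

lemma orb_0_minus_mid:
  assumes x: "x \<in> carrier_vec (n + 4)" and i: "2 \<le> i" "i < n + 2" and "x $ (n + 3) = 0"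
  obtains y where "orb x y" "y $ 0 = x $ 0 - (Q *\<^sub>v x) $ i"
proof
  show "orb x (x + bil (u 0) x \<cdot>\<^sub>v u i - (bil (u i) x + bil (u i) (u i) div 2 * bil (u 0) x) \<cdot>\<^sub>v u 0)"
    using assms by (intro orb_eichler) (auto simp: bil_u)
  have "bil (u i) x = (Q *\<^sub>v x) $ i" using x i by (intro bil_unit) auto
  then show "(x + bil (u 0) x \<cdot>\<^sub>v u i - (bil (u i) x + bil (u i) (u i) div 2 * bil (u 0) x) \<cdot>\<^sub>v u 0) $ 0
      = x $ 0 - (Q *\<^sub>v x) $ i"
    using assms by (auto simp: bil_u)
qed

lemma orb_1_minus_mid:
  assumes x: "x \<in> carrier_vec (n + 4)" and i: "2 \<le> i" "i < n + 2" and "x $ (n + 2) = 0"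
  obtains y where "orb x y" "y $ 1 = x $ 1 - (Q *\<^sub>v x) $ i" "y $ 0 = x $ 0"
proof
  show "orb x (x + bil (u 1) x \<cdot>\<^sub>v u i - (bil (u i) x + bil (u i) (u i) div 2 * bil (u 1) x) \<cdot>\<^sub>v u 1)"
    using assms by (intro orb_eichler) (auto simp: bil_u)
  have "bil (u i) x = (Q *\<^sub>v x) $ i" using x i by (intro bil_unit) auto
  then show "(x + bil (u 1) x \<cdot>\<^sub>v u i - (bil (u i) x + bil (u i) (u i) div 2 * bil (u 1) x) \<cdot>\<^sub>v u 1) $ 1
      = x $ 1 - (Q *\<^sub>v x) $ i"
    using assms by (auto simp: bil_u)
qed (use assms in \<open>auto simp: bil_u\<close>)

lemma orb_clear_mid:
  assumes x: "x \<in> carrier_vec (n + 4)" and "x $ 0 = 1"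
  obtains y where "orb x y" "y $ 0 = 1" "\<And>i. 2 \<le> i \<Longrightarrow> i < n + 2 \<Longrightarrow> y $ i = 0"
proof -
  \<comment> \<open>Here \<open>bil (u (n + 3)) x = x $ 0 = 1\<close>, so \<open>w\<close> is added
    exactly once and cancels the middle block; the correction falls on the last coordinate.\<close>
  define w where "w = vec (n + 4) (\<lambda>i. if 2 \<le> i \<and> i < n + 2 then - x $ i else 0)"
  have "orb x (x + bil (u (n + 3)) x \<cdot>\<^sub>v w -
      (bil w x + bil w w div 2 * bil (u (n + 3)) x) \<cdot>\<^sub>v u (n + 3))"
    using x by (intro orb_eichler) (auto simp: bil_u w_def)
  then show ?thesis
    by (rule that) (use assms in \<open>auto simp: bil_u w_def\<close>)
qed

section \<open>Reduction of primitive isotropic vectors to the first unit vector\<close>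

lemma orb_refl:
  assumes x: "x \<in> carrier_vec (n + 4)"
  shows "orb x x"
proof -
  have "x + (0 * bil (u 0) x) \<cdot>\<^sub>v u 1 - (0 * bil (u 1) x) \<cdot>\<^sub>v u 0 = x"
    using x by (intro eq_vecI) auto
  moreover have "orb x (x + (0 * bil (u 0) x) \<cdot>\<^sub>v u 1 - (0 * bil (u 1) x) \<cdot>\<^sub>v u 0)"
    using x by (intro orb_unit_unit) (auto simp: bil_u)
  ultimately show ?thesis by simp
qed

text \<open>A nonzero coordinate 1 or \<open>n + 2\<close> is moved to position 0 directly, a
  nonzero coordinate \<open>n + 3\<close> by way of position 1. If all four vanish, a middle entry
  of \<open>Q *\<^sub>v x\<close> is nonzero and is moved instead.\<close>

lemma orb_first_nonzero:
  assumes x: "x \<in> carrier_vec (n + 4)" and nz: "i < n + 4" "(Q *\<^sub>v x) $ i \<noteq> 0"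
  obtains y where "orb x y" "y $ 0 \<noteq> 0"
proof -
  have *: "\<exists>y. orb x y \<and> y $ 0 \<noteq> 0" if x: "x \<in> carrier_vec (n + 4)" and "x $ 0 \<noteq> 0 \<or> x $ 1 \<noteq> 0" for x
  proof (cases "x $ 0 = 0")
    case True
    obtain y where "orb x y" "y $ 0 = x $ 0 - 1 * x $ 1" by (rule orb_0_minus_1[OF x])
    then show ?thesis using True that by auto
  qed (use orb_refl[OF x] in blast)
  consider "x $ 0 \<noteq> 0 \<or> x $ 1 \<noteq> 0" | "x $ 0 = 0" "x $ (n + 2) \<noteq> 0"
    | "x $ 0 = 0" "x $ 1 = 0" "x $ (n + 2) = 0" "x $ (n + 3) \<noteq> 0"
    | "x $ 0 = 0" "x $ 1 = 0" "x $ (n + 2) = 0" "x $ (n + 3) = 0" by blast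
  then have "\<exists>y. orb x y \<and> y $ 0 \<noteq> 0"
  proof cases
    case 1
    then show ?thesis using * x by blast
  next
    case 2
    obtain y where "orb x y" "y $ 0 = x $ 0 - 1 * x $ (n + 2)" by (rule orb_0_minus_p[OF x])
    then show ?thesis using 2 by auto
  next
    case 3
    obtain y where y: "orb x y" "y $ 1 = x $ 1 + x $ (n + 3)" by (rule orb_1_plus_l[OF x])
    obtain z where "orb y z" "z $ 0 \<noteq> 0" using *[OF orb_carrier(2)[OF y(1)]] y(2) 3 by auto
    then show ?thesis using orb_trans[OF y(1)] by blast
  next
    case 4
    have "i \<noteq> 0 \<and> i \<noteq> 1 \<and> i \<noteq> n + 2 \<and> i \<noteq> n + 3"
      using nz(2) 4 Q_0[OF x] Q_1[OF x] Q_p[OF x] Q_l[OF x] by metis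
    then have "2 \<le> i" "i < n + 2" using nz(1) by auto
    from orb_0_minus_mid[OF x this 4(4)] obtain y where "orb x y" "y $ 0 = x $ 0 - (Q *\<^sub>v x) $ i" .
    then show ?thesis using nz(2) 4 by auto
  qed
  then show ?thesis using that by blast
qed

lemma orb_unit_0:
  assumes h: "h \<in> carrier_vec (n + 4)" and iso: "bil h h = 0"
    and prim: "\<And>d. (\<And>i. i < n + 4 \<Longrightarrow> d dvd (Q *\<^sub>v h) $ i) \<Longrightarrow> is_unit d"
  shows "orb h (u 0)"
proof -
  \<comment> \<open>If all entries vanished, 0 would be a common divisor and hence a unit.\<close>
  have "\<exists>i<n + 4. (Q *\<^sub>v h) $ i \<noteq> 0" using prim[of 0] by force
  then obtain y where "orb h y" "y $ 0 \<noteq> 0" using orb_first_nonzero[OF h] by blast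
  from ex_has_least_nat[of "\<lambda>y. orb h y \<and> y $ 0 \<noteq> 0" y "\<lambda>y. nat \<bar>y $ 0\<bar>"] this
  obtain x where x: "orb h x" "x $ 0 \<noteq> 0"
    and least: "\<And>y. orb h y \<Longrightarrow> y $ 0 \<noteq> 0 \<Longrightarrow> \<bar>x $ 0\<bar> \<le> \<bar>y $ 0\<bar>"
    by (auto simp: nat_le_eq_zle)
  define a where "a = x $ 0"
  have a: "a \<noteq> 0" using x by (simp add: a_def)
  \<comment> \<open>Minimality concerns nonzero values only, so a zero remainder must be avoided: if
    \<open>c\<close> divides \<open>b\<close>, the quotient is lowered by one and the remainder is
    \<open>c\<close> itself.\<close>
  have small: "\<exists>k. b - k * c \<noteq> 0 \<and> \<bar>b - k * c\<bar> \<le> \<bar>c\<bar>" if "c \<noteq> 0" for b c :: int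
  proof (cases "c dvd b")
    case True
    then show ?thesis using that by (intro exI[of _ "b div c - 1"]) (auto simp: algebra_simps)
  next
    case False
    then show ?thesis using abs_mod_less[OF that, of b]
      by (intro exI[of _ "b div c"]) (auto simp: minus_div_mult_eq_mod dvd_eq_mod_eq_0)
  qed
  \<comment> \<open>Reducing coordinate 0 by coordinate 1 leaves a nonzero value of size at most
    \<open>\<bar>y $ 1\<bar>\<close>, which minimality bounds from below by
    \<open>\<bar>a\<bar>\<close>.\<close>
  have le_1: "\<bar>a\<bar> \<le> \<bar>y $ 1\<bar>" if y: "orb h y" "y $ 1 \<noteq> 0" for y
  proof -
    obtain k where k: "y $ 0 - k * y $ 1 \<noteq> 0" "\<bar>y $ 0 - k * y $ 1\<bar> \<le> \<bar>y $ 1\<bar>" using small[OF y(2)] by blast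
    obtain z where z: "orb y z" "z $ 0 = y $ 0 - k * y $ 1" by (rule orb_0_minus_1[OF orb_carrier(2)[OF y(1)]])
    show ?thesis using least[OF orb_trans[OF y(1) z(1)]] k z(2) by (simp add: a_def)
  qed
  have le_p: "\<bar>a\<bar> \<le> \<bar>y $ (n + 2)\<bar>" if y: "orb h y" "y $ (n + 2) \<noteq> 0" for y
  proof -
    obtain k where k: "y $ 0 - k * y $ (n + 2) \<noteq> 0" "\<bar>y $ 0 - k * y $ (n + 2)\<bar> \<le> \<bar>y $ (n + 2)\<bar>"
      using small[OF y(2)] by blast
    obtain z where z: "orb y z" "z $ 0 = y $ 0 - k * y $ (n + 2)" by (rule orb_0_minus_p[OF orb_carrier(2)[OF y(1)]])
    show ?thesis using least[OF orb_trans[OF y(1) z(1)]] k z(2) by (simp add: a_def)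
  qed
  \<comment> \<open>Coordinate 1 can be replaced by its remainder modulo \<open>a\<close>; this is
    smaller than \<open>\<bar>a\<bar>\<close>, so it is zero by the previous bound.\<close>
  have dvd_1: "a dvd y $ 1" if y: "orb h y" "y $ 0 = a" for y
  proof -
    obtain z where z: "orb y z" "z $ 1 = y $ 1 - (y $ 1 div a) * y $ 0"
      by (rule orb_1_minus_0[OF orb_carrier(2)[OF y(1)]])
    have "z $ 1 = y $ 1 mod a" using z(2) y(2) by (simp add: minus_div_mult_eq_mod)
    then show ?thesis using le_1[OF orb_trans[OF y(1) z(1)]] abs_mod_less[OF a, of "y $ 1"]
      by (auto simp: dvd_eq_mod_eq_0)
  qed
  obtain y where y: "orb x y" "y $ 1 = x $ 1 - (x $ 1 div a) * x $ 0" "y $ 0 = x $ 0"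
    by (rule orb_1_minus_0[OF orb_carrier(2)[OF x(1)]])
  have y1: "y $ 1 = 0" using y(2) dvd_1[OF x(1)] by (simp add: a_def)
  have hy: "orb h y" by (rule orb_trans[OF x(1) y(1)])
  obtain z where z: "orb y z" "z $ (n + 2) = y $ (n + 2) - (y $ (n + 2) div a) * y $ 0" "z $ 0 = y $ 0" "z $ 1 = y $ 1"
    by (rule orb_p_minus_0[OF orb_carrier(2)[OF y(1)]])
  have hz: "orb h z" by (rule orb_trans[OF hy z(1)])
  have z0: "z $ 0 = a" using z y by (simp add: a_def)
  have "z $ (n + 2) = y $ (n + 2) mod a" using z(2) y(3) by (simp add: a_def minus_div_mult_eq_mod)
  then have zp: "z $ (n + 2) = 0" using le_p[OF hz] abs_mod_less[OF a, of "y $ (n + 2)"] by auto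
  have z1: "z $ 1 = 0" using z y1 by simp
  have zc: "z \<in> carrier_vec (n + 4)" by (rule orb_carrier(2)[OF hz])
  \<comment> \<open>Since \<open>z $ (n + 2) = 0\<close>, moving the last coordinate to position 1
    keeps coordinate 0 equal to \<open>a\<close>, so \<open>dvd_1\<close> applies to the result. The
    middle entries are treated alike.\<close>
  have "a dvd z $ (n + 3)"
  proof -
    obtain v where v: "orb z v" "v $ 1 = z $ 1 + z $ (n + 3)" "v $ 0 = z $ 0 - z $ (n + 2)"
      by (rule orb_1_plus_l[OF zc])
    then show ?thesis using dvd_1[OF orb_trans[OF hz v(1)]] z0 z1 zp by simp
  qed
  moreover have "a dvd (Q *\<^sub>v z) $ i" if i: "2 \<le> i" "i < n + 2" for i
  proof -
    obtain v where v: "orb z v" "v $ 1 = z $ 1 - (Q *\<^sub>v z) $ i" "v $ 0 = z $ 0"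
      by (rule orb_1_minus_mid[OF zc i zp])
    then show ?thesis using dvd_1[OF orb_trans[OF hz v(1)]] z0 z1 by simp
  qed
  ultimately have "a dvd (Q *\<^sub>v z) $ i" if "i < n + 4" for i
  proof -
    have "i = 0 \<or> i = 1 \<or> i = n + 2 \<or> i = n + 3 \<or> 2 \<le> i \<and> i < n + 2" using that by arith
    then show ?thesis
      using \<open>a dvd z $ (n + 3)\<close> \<open>\<And>i. 2 \<le> i \<Longrightarrow> i < n + 2 \<Longrightarrow> a dvd (Q *\<^sub>v z) $ i\<close>
        Q_0[OF zc] Q_1[OF zc] Q_p[OF zc] Q_l[OF zc] z0 z1 zp by auto
  qed
  \<comment> \<open>Divisibility of all entries passes back along the orbit from \<open>z\<close> to
    \<open>h\<close>, where primitivity applies.\<close>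
  then have "is_unit a" using orb_dvd[OF hz] prim by blast
  then have aa: "a * a = 1" by (auto simp: zdvd1_eq abs_if split: if_splits)
  \<comment> \<open>The sign of \<open>a\<close> is removed through coordinate 1: the factor
    \<open>- a\<close> creates \<open>a * a = 1\<close> there, and with this 1 coordinate 0 is then
    set to 1.\<close>
  obtain v where v: "orb z v" "v $ 1 = z $ 1 - (- a) * z $ 0" by (rule orb_1_minus_0[OF zc])
  have v1: "v $ 1 = 1" using v z0 z1 aa by simp
  obtain r where r: "orb v r" "r $ 0 = v $ 0 - (v $ 0 - 1) * v $ 1"
    by (rule orb_0_minus_1[OF orb_carrier(2)[OF v(1)]])
  have "r $ 0 = 1" using r v1 by simp
  then obtain s where s: "orb r s" "s $ 0 = 1" "\<And>i. 2 \<le> i \<Longrightarrow> i < n + 2 \<Longrightarrow> s $ i = 0"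
    using orb_clear_mid[OF orb_carrier(2)[OF r(1)]] by blast
  obtain t where t: "orb s t" "t $ 1 = s $ 1 - (s $ 1) * s $ 0" "t $ 0 = s $ 0"
      "\<And>i. 2 \<le> i \<Longrightarrow> i < n + 2 \<Longrightarrow> t $ i = s $ i"
    by (rule orb_1_minus_0[OF orb_carrier(2)[OF s(1)]]) blast
  obtain q where q: "orb t q" "q $ (n + 2) = t $ (n + 2) - (t $ (n + 2)) * t $ 0" "q $ 0 = t $ 0" "q $ 1 = t $ 1"
      "\<And>i. 2 \<le> i \<Longrightarrow> i < n + 2 \<Longrightarrow> q $ i = t $ i"
    by (rule orb_p_minus_0[OF orb_carrier(2)[OF t(1)]]) blast
  have hq: "orb h q" using hz v(1) r(1) s(1) t(1) q(1) orb_trans by blast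
  have qc: "q \<in> carrier_vec (n + 4)" by (rule orb_carrier(2)[OF hq])
  have q_eq: "q = u 0 + q $ (n + 3) \<cdot>\<^sub>v u (n + 3)"
  proof (rule eq_vecI)
    fix i assume "i < dim_vec (u 0 + q $ (n + 3) \<cdot>\<^sub>v u (n + 3))"
    then have i: "i < n + 4" by simp
    then have "i = 0 \<or> i = 1 \<or> i = n + 2 \<or> i = n + 3 \<or> 2 \<le> i \<and> i < n + 2" by arith
    then show "q $ i = (u 0 + q $ (n + 3) \<cdot>\<^sub>v u (n + 3)) $ i"
      using i q t s by auto
  qed (use qc in auto)
  \<comment> \<open>Only the last coordinate is left undetermined, and isotropy forces it to be
    zero.\<close>
  have "bil q q = 2 * q $ (n + 3)"
    by (subst (1 2) q_eq) (simp add: bil_simps bil_u)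
  then have "q $ (n + 3) = 0" using orb_bil[OF hq] iso by simp
  moreover have "0 \<cdot>\<^sub>v u (n + 3) = 0\<^sub>v (n + 4)" by (intro eq_vecI) auto
  ultimately have "q = u 0" using q_eq by simp
  then show ?thesis using hq by simp
qed

end

section \<open>The lattice of \<open>S\<^sub>1\<close>\<close>

text \<open>By symmetry the off-diagonal terms occur in equal pairs, and the diagonal coefficients
  are even.\<close>

lemma even_quadratic_form:
  fixes A :: "nat \<Rightarrow> nat \<Rightarrow> int"
  assumes "\<And>i j. i < m \<Longrightarrow> j < m \<Longrightarrow> A i j = A j i" "\<And>i. i < m \<Longrightarrow> even (A i i)"
  shows "even (\<Sum>i<m. \<Sum>j<m. x i * A i j * x j)"
  using assms
proof (induction m)
  case (Suc m)
  have "(\<Sum>i<m. x i * A i m * x m) = (\<Sum>j<m. x m * A m j * x j)"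
    using Suc.prems by (intro sum.cong) auto
  then have "(\<Sum>i<Suc m. \<Sum>j<Suc m. x i * A i j * x j) =
      (\<Sum>i<m. \<Sum>j<m. x i * A i j * x j) + 2 * (\<Sum>j<m. x m * A m j * x j) + x m * A m m * x m"
    by (simp add: sum.distrib)
  moreover have "even (\<Sum>i<m. \<Sum>j<m. x i * A i j * x j)" using Suc.prems by (intro Suc.IH) auto
  ultimately show ?case using Suc.prems(2)[of m] by simp
qed simp

lemma hyp_extend_carrier:
  "A \<in> carrier_mat m m \<Longrightarrow> hyp_extend A \<in> carrier_mat (m + 2) (m + 2)"
  by (auto simp: hyp_extend_def Let_def)

lemma even_mat_uminus: "even_mat n A \<Longrightarrow> even_mat n (- A)"
  by (auto simp: even_mat_def transpose_uminus)

lemma even_mat_hyp_extend: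
  assumes "even_mat m A"
  shows "even_mat (m + 2) (hyp_extend A)"
proof -
  have A: "A \<in> carrier_mat m m" "\<And>i. i < m \<Longrightarrow> even (A $$ (i, i))"
    using assms by (auto simp: even_mat_def)
  have sym: "A $$ (i, j) = A $$ (j, i)" if "i < m" "j < m" for i j
    using assms that by (metis even_mat_def carrier_matD index_transpose_mat(1))
  have "transpose_mat (hyp_extend A) = hyp_extend A"
    using A(1) by (intro eq_matI) (auto simp: hyp_extend_def Let_def intro!: sym)
  then show ?thesis
    using A by (auto simp: even_mat_def hyp_extend_carrier) (auto simp: hyp_extend_def Let_def)
qed

lemma hyp_extend_mult_vec:
  assumes A: "A \<in> carrier_mat m m" and x: "x \<in> carrier_vec (m + 2)"
  shows "(hyp_extend A *\<^sub>v x) $ 0 = x $ (m + 1)"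
    "(hyp_extend A *\<^sub>v x) $ (m + 1) = x $ 0"
    "i < m \<Longrightarrow> (hyp_extend A *\<^sub>v x) $ (i + 1) = (A *\<^sub>v vec m (\<lambda>j. x $ (j + 1))) $ i"
proof -
  have *: "(hyp_extend A *\<^sub>v x) $ i = (\<Sum>j<m + 2. hyp_extend A $$ (i, j) * x $ j)" if "i < m + 2" for i
    using that x hyp_extend_carrier[OF A] by (simp add: scalar_prod_def atLeast0LessThan)
  have r: "row (hyp_extend A) 0 = unit_vec (m + 2) (m + 1)" "row (hyp_extend A) (m + 1) = unit_vec (m + 2) 0"
    using A by (auto simp: hyp_extend_def Let_def)
  show "(hyp_extend A *\<^sub>v x) $ 0 = x $ (m + 1)" "(hyp_extend A *\<^sub>v x) $ (m + 1) = x $ 0"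
    using r x carrier_matD[OF hyp_extend_carrier[OF A]] by (simp_all del: add_2_eq_Suc')
  assume i: "i < m"
  have "(hyp_extend A *\<^sub>v x) $ (i + 1) = (\<Sum>j<Suc (Suc m). hyp_extend A $$ (i + 1, j) * x $ j)"
    using i by (subst *) auto
  also have "\<dots> = (\<Sum>j<m. A $$ (i, j) * x $ (j + 1))"
    \<comment> \<open>The first and last summands vanish in a middle row; what remains is a row of
      \<open>A\<close> with indices shifted by one.\<close>
    unfolding sum.lessThan_Suc_shift[of _ "Suc m"] sum.lessThan_Suc[of _ m]
    using A i by (simp add: hyp_extend_def Let_def)
  finally show "(hyp_extend A *\<^sub>v x) $ (i + 1) = (A *\<^sub>v vec m (\<lambda>j. x $ (j + 1))) $ i"
    using A i by (simp add: scalar_prod_def atLeast0LessThan)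
qed

text \<open>A nonzero kernel vector would make the positive definite form vanish.\<close>

lemma pos_def_mat_nonsingular:
  fixes S :: "int mat"
  assumes "pos_def_mat n (map_mat real_of_int S)" "x \<in> carrier_vec n" "S *\<^sub>v x = 0\<^sub>v n"
  shows "x = 0\<^sub>v n"
proof (rule ccontr)
  assume "x \<noteq> 0\<^sub>v n"
  then have "map_vec real_of_int x \<noteq> 0\<^sub>v n" by simp
  moreover have "S \<in> carrier_mat n n" using assms(1) by (simp add: pos_def_mat_def)
  then have "map_mat real_of_int S *\<^sub>v map_vec real_of_int x = 0\<^sub>v n"
    using assms(2,3) by (simp flip: of_int_hom.mult_mat_vec_hom add: of_int_hom.vec_hom_zero)
  moreover have x: "map_vec real_of_int x \<in> carrier_vec n" using assms(2) by simp
  ultimately have "scalar_prod (map_vec real_of_int x) (0\<^sub>v n) > 0"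
    using assms(1) unfolding pos_def_mat_def by metis
  then show False using x by simp
qed

context
  fixes n :: nat and S :: "int mat"
  assumes S: "S \<in> carrier_mat n n" and ev: "even_mat n S" and pd: "pos_def_mat n (map_mat real_of_int S)"
begin

lemma S0_carrier: "S0 S \<in> carrier_mat (n + 2) (n + 2)"
  unfolding S0_def using S by (intro hyp_extend_carrier) simp

lemma even_mat_S1: "even_mat (n + 4) (S1 S)"
  using even_mat_hyp_extend[OF even_mat_hyp_extend[OF even_mat_uminus[OF ev]]]
  by (simp add: S0_def S1_def numeral_eq_Suc)

lemma S1_mult_vec:
  assumes x: "x \<in> carrier_vec (n + 4)"
  shows "(S1 S *\<^sub>v x) $ 0 = x $ (n + 3)" "(S1 S *\<^sub>v x) $ 1 = x $ (n + 2)"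
    "(S1 S *\<^sub>v x) $ (n + 2) = x $ 1" "(S1 S *\<^sub>v x) $ (n + 3) = x $ 0"
    "i < n \<Longrightarrow> (S1 S *\<^sub>v x) $ (i + 2) = - (S *\<^sub>v vec n (\<lambda>j. x $ (j + 2))) $ i"
proof -
  let ?y = "vec (n + 2) (\<lambda>j. x $ (j + 1))"
  have x': "x \<in> carrier_vec (n + 2 + 2)" using x by (simp add: numeral_eq_Suc)
  have S': "- S \<in> carrier_mat n n" using S by simp
  \<comment> \<open>The form is built from two layers, each shifting indices by one; hence the
    middle block starts at index 2.\<close>
  note outer = hyp_extend_mult_vec[OF S0_carrier x', folded S1_def]
  note inner = hyp_extend_mult_vec[OF S' vec_carrier[of "n + 2" "\<lambda>j. x $ (j + 1)"], folded S0_def]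
  show "(S1 S *\<^sub>v x) $ 0 = x $ (n + 3)" "(S1 S *\<^sub>v x) $ (n + 3) = x $ 0"
    using outer(1,2) by (simp_all add: numeral_eq_Suc)
  show "(S1 S *\<^sub>v x) $ 1 = x $ (n + 2)" using outer(3)[of 0] inner(1) by simp
  show "(S1 S *\<^sub>v x) $ (n + 2) = x $ 1" using outer(3)[of "n + 1"] inner(2) by simp
  assume i: "i < n"
  have "vec n (\<lambda>j. ?y $ (j + 1)) = vec n (\<lambda>j. x $ (j + 2))" by (intro eq_vecI) auto
  then show "(S1 S *\<^sub>v x) $ (i + 2) = - (S *\<^sub>v vec n (\<lambda>j. x $ (j + 2))) $ i"
    using outer(3)[of "i + 1"] inner(3)[OF i] i S by simp
qed

text \<open>For a kernel vector the hyperbolic equations kill coordinates 0, 1, \<open>n + 2\<close>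
  and \<open>n + 3\<close>; the middle part lies in the kernel of \<open>S\<close>, which is
  trivial.\<close>

lemma det_S1: "Determinant.det (S1 S) \<noteq> 0"
proof
  have S1: "S1 S \<in> carrier_mat (n + 4) (n + 4)" using even_mat_S1 by (simp add: even_mat_def)
  assume "Determinant.det (S1 S) = 0"
  then obtain x where x: "x \<in> carrier_vec (n + 4)" "x \<noteq> 0\<^sub>v (n + 4)" "S1 S *\<^sub>v x = 0\<^sub>v (n + 4)"
    using det_0_iff_vec_prod_zero[OF S1] by auto
  note mv = S1_mult_vec[OF x(1), unfolded x(3)]
  have "S *\<^sub>v vec n (\<lambda>j. x $ (j + 2)) = 0\<^sub>v n"
  proof (rule eq_vecI)
    fix i assume "i < dim_vec (0\<^sub>v n :: int vec)"
    then have i: "i < n" by simp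
    have "(0\<^sub>v (n + 4) :: int vec) $ (i + 2) = 0" using i by (intro index_zero_vec(1)) simp
    then show "(S *\<^sub>v vec n (\<lambda>j. x $ (j + 2))) $ i = 0\<^sub>v n $ i"
      unfolding index_zero_vec(1)[OF i] using mv(5)[OF i] by linarith
  qed (use S in simp)
  then have "vec n (\<lambda>j. x $ (j + 2)) = 0\<^sub>v n" by (rule pos_def_mat_nonsingular[OF pd vec_carrier])
  then have mid: "x $ (j + 2) = 0" if "j < n" for j using that by (metis index_vec index_zero_vec(1))
  have "x $ i = 0" if "i < n + 4" for i
  proof -
    have "i = 0 \<or> i = 1 \<or> i = n + 2 \<or> i = n + 3 \<or> (\<exists>j<n. i = j + 2)" using that by presburger
    then show ?thesis using mv(1-4) mid by auto
  qed
  then show False using x(1,2) by (auto intro!: eq_vecI)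
qed

interpretation hyperbolic_lattice n "S1 S"
proof
  show S1: "S1 S \<in> carrier_mat (n + 4) (n + 4)" and sym: "transpose_mat (S1 S) = S1 S"
    using even_mat_S1 by (auto simp: even_mat_def)
  interpret quadratic_space "n + 4" "S1 S" by standard fact+
  fix x :: "int vec" assume x: "x \<in> carrier_vec (n + 4)"
  have bil: "bil x x = (\<Sum>i<n + 4. \<Sum>j<n + 4. x $ i * S1 S $$ (i, j) * x $ j)"
    using carrier_matD[OF S1] carrier_vecD[OF x]
    by (simp add: bil_def scalar_prod_def atLeast0LessThan sum_distrib_left mult.assoc)
  show "even (bil x x)"
    unfolding bil
  proof (rule even_quadratic_form)
    fix i j assume "i < n + 4" "j < n + 4"
    then show "S1 S $$ (i, j) = S1 S $$ (j, i)"
      using arg_cong[OF sym, of "\<lambda>A. A $$ (i, j)"] carrier_matD[OF S1] by simp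
  next
    fix i assume "i < n + 4"
    then show "even (S1 S $$ (i, i))"
      using even_mat_S1 by (simp add: even_mat_def)
  qed
qed (rule det_S1 | erule S1_mult_vec(1-4))+

text \<open>Symmetry of \<open>S1 S\<close> turns the row condition into one on
  \<open>S1 S *\<^sub>v h\<close>.\<close>

lemma row_vec_mult_S1:
  assumes h: "h \<in> carrier_vec (n + 4)"
  shows "row_vec_mult h (S1 S) = S1 S *\<^sub>v h"
proof (rule eq_vecI)
  fix i assume "i < dim_vec (S1 S *\<^sub>v h)"
  then have i: "i < n + 4" using carrier_matD[OF Q] by simp
  have "col (S1 S) i = row (S1 S) i" using sym i carrier_matD[OF Q] by (metis row_transpose)
  then show "row_vec_mult h (S1 S) $ i = (S1 S *\<^sub>v h) $ i"
    using i h carrier_matD[OF Q] comm_scalar_prod[of h "n + 4" "row (S1 S) i"] row_carrier_vec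
    by (simp add: row_vec_mult_def row_mult)
qed (use carrier_matD[OF Q] in \<open>simp add: row_vec_mult_def\<close>)

lemma gcd_vec_eq_1_iff:
  assumes "v \<in> carrier_vec m"
  shows "gcd_vec v = 1 \<longleftrightarrow> (\<forall>d. (\<forall>i<m. d dvd v $ i) \<longrightarrow> is_unit d)"
proof -
  have "d dvd gcd_vec v \<longleftrightarrow> (\<forall>i<m. d dvd v $ i)" for d
    using assms by (auto simp: gcd_vec_def vec_set_def dvd_Gcd_iff)
  moreover have "gcd_vec v = 1 \<longleftrightarrow> is_unit (gcd_vec v)"
    by (simp add: gcd_vec_def zdvd1_eq)
  ultimately show ?thesis by (metis dvd_trans dvd_refl)
qed

section \<open>Columns and rows of integral isometries\<close>

lemma Gamma_isometry:
  assumes "M \<in> Gamma n S"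
  shows "M \<in> carrier_mat (n + 4) (n + 4)" "transpose_mat M * S1 S * M = S1 S" "Determinant.det M = 1"
proof -
  show M: "M \<in> carrier_mat (n + 4) (n + 4)" using assms by (simp add: Gamma_def)
  have *: "map_mat real_of_int M \<in> SO_real (n + 4) Qr"
    using assms SO_plus_subset by (auto simp: Gamma_def)
  then show "Determinant.det M = 1" by (simp add: SO_real_def SL_real_def)
  have "transpose_mat (map_mat real_of_int M) * Qr * map_mat real_of_int M = Qr"
    using * by (simp add: SO_real_def)
  then show "transpose_mat M * S1 S * M = S1 S"
    by (rule real_isometry_imp_isometry[OF M])
qed

text \<open>Both conditions depend on \<open>S1 S *\<^sub>v h\<close> alone: by symmetry,
  \<open>bil h h\<close> = \<open>bil h k\<close> = \<open>bil k h\<close> = \<open>bil k k\<close>.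
  For columns \<open>k\<close> is \<open>h\<close>; for rows it is a preimage of
  \<open>u 0\<close>.\<close>

lemma isotropic_primitive:
  assumes h: "h \<in> carrier_vec (n + 4)" and k: "k \<in> carrier_vec (n + 4)"
    and eq: "S1 S *\<^sub>v h = S1 S *\<^sub>v k" and iso: "bil k k = 0"
    and prim: "\<And>d. (\<And>i. i < n + 4 \<Longrightarrow> d dvd (S1 S *\<^sub>v k) $ i) \<Longrightarrow> is_unit d"
  shows "scalar_prod h (S1 S *\<^sub>v h) = 0 \<and> gcd_vec (S1 S *\<^sub>v h) = 1"
proof
  have "scalar_prod h (S1 S *\<^sub>v h) = bil h k" by (simp add: eq bil_def)
  also have "\<dots> = bil k h" using h k by (simp add: bil_commute)
  also have "\<dots> = bil k k" by (simp add: eq bil_def)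
  finally show "scalar_prod h (S1 S *\<^sub>v h) = 0" using iso by simp
  show "gcd_vec (S1 S *\<^sub>v h) = 1"
    unfolding eq gcd_vec_eq_1_iff[OF Q_mult_vec_carrier[OF k]] using prim by blast
qed

lemma Gamma_col_imp:
  assumes "M \<in> Gamma n S" and h: "h = col M 0"
  shows "scalar_prod h (S1 S *\<^sub>v h) = 0 \<and> gcd_vec (S1 S *\<^sub>v h) = 1"
proof -
  note M = Gamma_isometry[OF assms(1)]
  have hu: "h = M *\<^sub>v u 0"
    unfolding h using M(1) by (intro eq_vecI) auto
  then have hc: "h \<in> carrier_vec (n + 4)" using M(1) by simp
  have "bil h h = bil (u 0) (u 0)"
    using isometry_iff[OF M(1)] M(2) by (simp add: hu)
  then have "bil h h = 0" by (simp add: bil_u)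
  moreover have "is_unit d" if d: "\<And>i. i < n + 4 \<Longrightarrow> d dvd (S1 S *\<^sub>v h) $ i" for d
  proof -
    \<comment> \<open>This entry is 1, so a common divisor for the image of \<open>u 0\<close> is a
      unit.\<close>
    have "d dvd (S1 S *\<^sub>v u 0) $ (n + 3)"
    proof (rule isometry_dvd[OF M(1,2)])
      show "d dvd (S1 S *\<^sub>v (M *\<^sub>v u 0)) $ i" if "i < n + 4" for i
        using d[OF that] unfolding hu .
    qed simp_all
    then show ?thesis by (simp add: Q_l)
  qed
  ultimately show ?thesis by (rule isotropic_primitive[OF hc hc refl])
qed

text \<open>Writing Q for \<open>S1 S\<close>, Qk = M^t Q M k = M^t Q (\<open>u 0\<close>), and Q
  sends \<open>u 0\<close> to the last unit vector, at index \<open>n + 3\<close>.\<close>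

lemma isometry_row:
  assumes M: "M \<in> carrier_mat (n + 4) (n + 4)" "transpose_mat M * S1 S * M = S1 S"
    and k: "k \<in> carrier_vec (n + 4)" and Mk: "M *\<^sub>v k = u 0"
  shows "row M (n + 3) = S1 S *\<^sub>v k"
proof -
  have Su: "S1 S *\<^sub>v u 0 = u (n + 3)"
  proof (rule eq_vecI)
    fix i assume "i < dim_vec (u (n + 3))"
    then have i: "i < n + 4" by simp
    have "(S1 S *\<^sub>v u 0) $ i = bil (u i) (u 0)" using i by (simp add: bil_unit)
    also have "\<dots> = bil (u 0) (u i)" by (simp add: bil_commute)
    finally have "(S1 S *\<^sub>v u 0) $ i = bil (u 0) (u i)" .
    then show "(S1 S *\<^sub>v u 0) $ i = u (n + 3) $ i" using i by (simp add: bil_u)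
  qed (use carrier_matD[OF Q] in simp)
  have "S1 S *\<^sub>v k = (transpose_mat M * S1 S * M) *\<^sub>v k" using M(2) by simp
  also have "\<dots> = transpose_mat M *\<^sub>v (S1 S *\<^sub>v (M *\<^sub>v k))"
    using M(1) Q k by (simp add: assoc_mult_mat_vec[where n\<^sub>1 = "n + 4" and n\<^sub>2 = "n + 4" and n\<^sub>3 = "n + 4"]
         mult_carrier_mat[where nr = "n + 4" and n = "n + 4" and nc = "n + 4"])
  also have "\<dots> = row M (n + 3)"
    unfolding Mk Su using M(1) by (intro eq_vecI) auto
  finally show ?thesis ..
qed

lemma Gamma_row_imp:
  assumes "M \<in> Gamma n S" and h: "h \<in> carrier_vec (n + 4)" and Sh: "S1 S *\<^sub>v h = row M (n + 3)"
  shows "scalar_prod h (S1 S *\<^sub>v h) = 0 \<and> gcd_vec (S1 S *\<^sub>v h) = 1"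
proof -
  note M = Gamma_isometry[OF assms(1)]
  \<comment> \<open>As the determinant is 1, the adjugate is an integral inverse.\<close>
  define A where "A = adj_mat M"
  have A: "A \<in> carrier_mat (n + 4) (n + 4)" "M * A = 1\<^sub>m (n + 4)"
    using adj_mat[OF M(1)] M(3) by (auto simp: A_def)
  define k where "k = A *\<^sub>v u 0"
  have k: "k \<in> carrier_vec (n + 4)" using A by (simp add: k_def)
  have Mk: "M *\<^sub>v k = u 0"
    unfolding k_def using assoc_mult_mat_vec[OF M(1) A(1), of "u 0"] A(2) by simp
  have row: "row M (n + 3) = S1 S *\<^sub>v k" by (rule isometry_row[OF M(1,2) k Mk])
  have "bil k k = bil (u 0) (u 0)" using isometry_iff[OF M(1)] M(2) k Mk by metis
  then have "bil k k = 0" by (simp add: bil_u)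
  moreover have "is_unit d" if d: "\<And>i. i < n + 4 \<Longrightarrow> d dvd (S1 S *\<^sub>v k) $ i" for d
  proof -
    \<comment> \<open>A common divisor of the last row of \<open>M\<close> divides this diagonal
      entry of the identity matrix.\<close>
    have "(M * A) $$ (n + 3, n + 3) = (\<Sum>i<n + 4. row M (n + 3) $ i * A $$ (i, n + 3))"
      using M(1) A(1) by (simp add: scalar_prod_def atLeast0LessThan)
    moreover have "d dvd (\<Sum>i<n + 4. row M (n + 3) $ i * A $$ (i, n + 3))"
      using d by (auto intro!: dvd_sum dvd_mult2 simp: row)
    ultimately show ?thesis using A(2) by simp
  qed
  ultimately show ?thesis using Sh row by (intro isotropic_primitive[OF h k]) simp_all
qed

lemma stable_subset_Gamma_tilde: "stable \<subseteq> Gamma_tilde n S"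
  by (auto simp: stable_def Gamma_tilde_def Gamma_def intro: SO_path_imp_SO_plus)

lemma isotropic_primitive_imp:
  assumes h: "h \<in> carrier_vec (n + 4)"
    and iso: "scalar_prod h (S1 S *\<^sub>v h) = 0" and prim: "gcd_vec (S1 S *\<^sub>v h) = 1"
  shows "\<exists>M\<in>Gamma_tilde n S. h = col M 0" "\<exists>M\<in>Gamma_tilde n S. S1 S *\<^sub>v h = row M (n + 3)"
proof -
  have "orb h (u 0)"
    using iso prim unfolding gcd_vec_eq_1_iff[OF Q_mult_vec_carrier[OF h]]
    by (intro orb_unit_0[OF h]) (auto simp: bil_def)
  then obtain M M' where M: "M \<in> stable" "M' \<in> stable" "M *\<^sub>v h = u 0" "M' *\<^sub>v u 0 = h"
    unfolding orb_def by blast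
  have "M' \<in> carrier_mat (n + 4) (n + 4)" using M(2) by (simp add: stable_def)
  then have "col M' 0 = M' *\<^sub>v u 0" by (intro eq_vecI) auto
  then show "\<exists>M\<in>Gamma_tilde n S. h = col M 0"
    using M(2,4) stable_subset_Gamma_tilde by (intro bexI[of _ M']) auto
  have "M \<in> carrier_mat (n + 4) (n + 4)" using M(1) by (simp add: stable_def)
  from isometry_row[OF this stable_isometry[OF M(1)] h M(3)]
  show "\<exists>M\<in>Gamma_tilde n S. S1 S *\<^sub>v h = row M (n + 3)"
    using M(1) stable_subset_Gamma_tilde by (intro bexI[of _ M]) auto
qed

end

theorem theorem1:
  fixes n :: nat and S :: "int mat" and h :: "int vec"
  assumes "S \<in> carrier_mat n n"
    and "even_mat n S"
    and "pos_def_mat n (map_mat real_of_int S)"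
    and "h \<in> carrier_vec (n + 4)"
  shows
    "((\<exists>M \<in> Gamma n S. h = Matrix.col M 0)
        \<longleftrightarrow> (\<exists>M \<in> Gamma n S. row_vec_mult h (S1 S) = Matrix.row M (n + 3)))
     \<and> ((\<exists>M \<in> Gamma n S. row_vec_mult h (S1 S) = Matrix.row M (n + 3))
        \<longleftrightarrow> scalar_prod h (S1 S *\<^sub>v h) = 0 \<and> gcd_vec (S1 S *\<^sub>v h) = 1)
     \<and> ((\<exists>M \<in> Gamma_tilde n S. h = Matrix.col M 0)
        \<longleftrightarrow> (\<exists>M \<in> Gamma_tilde n S. row_vec_mult h (S1 S) = Matrix.row M (n + 3)))
     \<and> ((\<exists>M \<in> Gamma_tilde n S. row_vec_mult h (S1 S) = Matrix.row M (n + 3))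
        \<longleftrightarrow> scalar_prod h (S1 S *\<^sub>v h) = 0 \<and> gcd_vec (S1 S *\<^sub>v h) = 1)"
proof -
  note col = Gamma_col_imp[OF assms(1-3)]
  note row = Gamma_row_imp[OF assms(1-3) _ assms(4)]
  note ex = isotropic_primitive_imp[OF assms]
  \<comment> \<open>The conditions produce matrices in the smaller group, while matrices in the
    larger group already imply the conditions; the inclusion closes both cycles.\<close>
  have sub: "Gamma_tilde n S \<subseteq> Gamma n S" by (auto simp: Gamma_tilde_def)
  show ?thesis
    unfolding row_vec_mult_S1[OF assms] using col row ex sub by blast
qed

end
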